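(* Let $(L,\prec)$ be a proximity frame. The relation $\sqsubseteq$ on the frame $\mathfrak{R}L$ of round ideals of $L$ defined by $$I\sqsubseteq J\iff I\subseteq J\ \text{ and }\ I\ll\kappa_L(\varsigma_L(J))$$ is a proximity on $\mathfrak{R}L$. Moreover $\sqsubseteq$ is maximal in the sense that $I\sqsubseteq J$ if and only if $I\subseteq J$ and $\varsigma_L(I)\prec\varsigma_L(J)$.
   Context: A proximity on a frame $L$ is a binary relation $\prec$ on $L$ such that: (1) $a\prec b$ implies $a\le b$, and $\prec$ is a (bounded) sublattice of $L\times L$, i.e. $0\prec 0$, $1\prec 1$, and $a_1\prec b_1$, $a_2\prec b_2$ imply $a_1\wedge a_2\prec b_1\wedge b_2$ and $a_1\vee a_2\prec b_1\vee b_2$; (2) $a\le b\prec c\le d$ implies $a\prec d$; (3) $a\prec b$ implies $a\prec c\prec b$ for some $c$; (4) $a=\bigvee\{b\mid b\prec a\}$ for all $a\in L$. The pair $(L,\prec)$ is a proximity frame. An ideal of $L$ is a downset closed under finite joins (in particular it contains $0$). An ideal $I$ is round if for each $a\in I$ there is $b\in I$ with $a\prec b$. $\mathfrak{R}L$ is the frame of round ideals of $L$ ordered by inclusion (a subframe of the frame of ideals of $L$), and $\ll$ denotes its way-below relation: $x\ll y$ iff whenever $y\le\bigvee S$ there is a finite $F\subseteq S$ with $x\le\bigvee F$. $\varsigma_L:\mathfrak{R}L\to L$ is $\varsigma_L(I)=\bigvee I$, and $\kappa_L:L\to\mathfrak{R}L$ is $\kappa_L(a)=\{b\mid b\prec a\}$.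 *)

theory Defs
  imports "HOL-Algebra.Complete_Lattice"
begin

text \<open>Frames are carrier-based, so that one notion of proximity applies both to \<open>L\<close> and to the
  frame of round ideals of \<open>L\<close>, whose carrier depends on the proximity of \<open>L\<close>.\<close>

locale frame = complete_lattice L for L (structure) +
  assumes inf_Sup_distrib:
    "\<lbrakk> a \<in> carrier L; S \<subseteq> carrier L \<rbrakk> \<Longrightarrow> a \<sqinter> \<Squnion>S = \<Squnion>((\<lambda>s. a \<sqinter> s) ` S)"

text \<open>The assumption \<open>prec_carrier\<close> says that \<open>\<prec>\<close> is a relation on \<open>L\<close>, i.e. a subset of
  \<open>L \<times> L\<close>.\<close>

locale proximity_frame = frame L for L (structure) +
  fixes prec :: "'a \<Rightarrow> 'a \<Rightarrow> bool" (infix \<open>\<prec>\<close> 50)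
  assumes prec_carrier: "a \<prec> b \<Longrightarrow> a \<in> carrier L \<and> b \<in> carrier L"
    and prec_imp_le: "a \<prec> b \<Longrightarrow> a \<sqsubseteq> b"
    and prec_bottom: "\<bottom> \<prec> \<bottom>"
    and prec_top: "\<top> \<prec> \<top>"
    and prec_meet: "\<lbrakk> a1 \<prec> b1; a2 \<prec> b2 \<rbrakk> \<Longrightarrow> a1 \<sqinter> a2 \<prec> b1 \<sqinter> b2"
    and prec_join: "\<lbrakk> a1 \<prec> b1; a2 \<prec> b2 \<rbrakk> \<Longrightarrow> a1 \<squnion> a2 \<prec> b1 \<squnion> b2"
    and le_prec_le:
      "\<lbrakk> a \<in> carrier L; d \<in> carrier L; a \<sqsubseteq> b; b \<prec> c; c \<sqsubseteq> d \<rbrakk> \<Longrightarrow> a \<prec> d"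
    and prec_interpolate: "a \<prec> b \<Longrightarrow> \<exists>c. a \<prec> c \<and> c \<prec> b"
    and prec_approx: "a \<in> carrier L \<Longrightarrow> a = \<Squnion>{b. b \<prec> a}"

definition lattice_ideal :: "('a, 'm) gorder_scheme \<Rightarrow> 'a set \<Rightarrow> bool" where
  "lattice_ideal L I \<longleftrightarrow>
     I \<subseteq> carrier L \<and>
     (\<forall>a\<in>carrier L. \<forall>b\<in>I. a \<sqsubseteq>\<^bsub>L\<^esub> b \<longrightarrow> a \<in> I) \<and>
     \<bottom>\<^bsub>L\<^esub> \<in> I \<and>
     (\<forall>a\<in>I. \<forall>b\<in>I. a \<squnion>\<^bsub>L\<^esub> b \<in> I)"

definition round_ideal :: "('a, 'm) gorder_scheme \<Rightarrow> ('a \<Rightarrow> 'a \<Rightarrow> bool) \<Rightarrow> 'a set \<Rightarrow> bool" where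
  "round_ideal L prec I \<longleftrightarrow> lattice_ideal L I \<and> (\<forall>a\<in>I. \<exists>b\<in>I. prec a b)"

definition round_ideals :: "('a, 'm) gorder_scheme \<Rightarrow> ('a \<Rightarrow> 'a \<Rightarrow> bool) \<Rightarrow> 'a set gorder" where
  "round_ideals L prec = \<lparr>carrier = {I. round_ideal L prec I}, eq = (=), le = (\<subseteq>)\<rparr>"

definition way_below :: "('a, 'm) gorder_scheme \<Rightarrow> 'a \<Rightarrow> 'a \<Rightarrow> bool" where
  "way_below M x y \<longleftrightarrow>
     x \<in> carrier M \<and> y \<in> carrier M \<and>
     (\<forall>S. S \<subseteq> carrier M \<and> y \<sqsubseteq>\<^bsub>M\<^esub> \<Squnion>\<^bsub>M\<^esub>S \<longrightarrow> (\<exists>F. finite F \<and> F \<subseteq> S \<and> x \<sqsubseteq>\<^bsub>M\<^esub> \<Squnion>\<^bsub>M\<^esub>F))"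

definition ideal_join :: "('a, 'm) gorder_scheme \<Rightarrow> 'a set \<Rightarrow> 'a" where
  "ideal_join L I = \<Squnion>\<^bsub>L\<^esub>I"

definition kappa :: "('a, 'm) gorder_scheme \<Rightarrow> ('a \<Rightarrow> 'a \<Rightarrow> bool) \<Rightarrow> 'a \<Rightarrow> 'a set" where
  "kappa L prec a = {b \<in> carrier L. prec b a}"

definition round_ideal_prox ::
  "('a, 'm) gorder_scheme \<Rightarrow> ('a \<Rightarrow> 'a \<Rightarrow> bool) \<Rightarrow> 'a set \<Rightarrow> 'a set \<Rightarrow> bool" where
  "round_ideal_prox L prec I J \<longleftrightarrow>
     I \<in> carrier (round_ideals L prec) \<and> J \<in> carrier (round_ideals L prec) \<and>
     I \<subseteq> J \<and> way_below (round_ideals L prec) I (kappa L prec (ideal_join L J))"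

end

theory Submission
  imports Defs
begin

text \<open>Joins of round ideals are generated ideals, and every element of a generated ideal depends
  on finitely many generators. Since \<open>\<kappa>(c)\<close> is the directed union of the \<open>\<kappa>(b)\<close> with
  \<open>b \<prec> c\<close>, the relation \<open>I \<ll> \<kappa>(c)\<close> amounts to \<open>\<Squnion>I \<prec> c\<close>. With this description of the
  relation the proximity axioms are inherited from \<open>L\<close>, because \<open>I \<mapsto> \<Squnion>I\<close> preserves finite meets
  and joins and \<open>\<Squnion>\<kappa>(c) = c\<close>.\<close>

section \<open>Ideals generated by a subset of a frame\<close>

context frame
begin

text \<open>Encoded as an inductive closure rather than as the elements below finite joins, so that
  finiteness, distributivity and roundness can be proved by rule induction. The rule
  \<open>bottom\<close> makes the ideal generated by \<open>{}\<close> the zero ideal.\<close>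

inductive_set ideal_gen :: "'a set \<Rightarrow> 'a set" for U where
  bottom: "\<bottom> \<in> ideal_gen U"
| base: "u \<in> U \<Longrightarrow> u \<in> ideal_gen U"
| join: "\<lbrakk> a \<in> ideal_gen U; b \<in> ideal_gen U \<rbrakk> \<Longrightarrow> a \<squnion> b \<in> ideal_gen U"
| down: "\<lbrakk> b \<in> ideal_gen U; a \<in> carrier L; a \<sqsubseteq> b \<rbrakk> \<Longrightarrow> a \<in> ideal_gen U"

lemma ideal_gen_carrier:
  assumes "U \<subseteq> carrier L"
  shows "ideal_gen U \<subseteq> carrier L"
proof
  fix x assume "x \<in> ideal_gen U"
  then show "x \<in> carrier L" by induction (use assms in auto)
qed

lemma lattice_ideal_ideal_gen: "U \<subseteq> carrier L \<Longrightarrow> lattice_ideal L (ideal_gen U)"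
  unfolding lattice_ideal_def
  by (intro conjI ballI impI ideal_gen_carrier)
    (assumption | rule ideal_gen.bottom | erule (1) ideal_gen.join | erule (2) ideal_gen.down)+

lemma ideal_gen_least:
  assumes "lattice_ideal L I" "U \<subseteq> I"
  shows "ideal_gen U \<subseteq> I"
proof
  fix x assume "x \<in> ideal_gen U"
  then show "x \<in> I"
    by induction (use assms in \<open>auto simp: lattice_ideal_def\<close>)
qed

lemma ideal_gen_mono:
  assumes "U \<subseteq> V"
  shows "ideal_gen U \<subseteq> ideal_gen V"
proof
  fix x assume "x \<in> ideal_gen U"
  then show "x \<in> ideal_gen V"
    by induction (use assms in \<open>auto intro: ideal_gen.intros\<close>)
qed

lemma ideal_gen_le:
  assumes "U \<subseteq> carrier L" "z \<in> carrier L" "\<And>u. u \<in> U \<Longrightarrow> u \<sqsubseteq> z" "x \<in> ideal_gen U"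
  shows "x \<sqsubseteq> z"
  using assms(4)
proof induction
  case (join a b)
  then show ?case using ideal_gen_carrier[OF assms(1)] assms(2) by (auto intro: join_le)
next
  case (down b a)
  then show ?case using ideal_gen_carrier[OF assms(1)] assms(2) by (auto intro: le_trans)
qed (use assms in auto)

text \<open>A derivation has finitely many leaves, each in one member of \<open>S\<close>, and
  \<open>join\<close> unites the two finite families. Keeping a subfamily of \<open>S\<close>, not
  just a finite set of generators, is the form that \<open>way_below\<close> asks for.\<close>

lemma ideal_gen_Union_finite:
  assumes "x \<in> ideal_gen (\<Union>S)"
  shows "\<exists>F. finite F \<and> F \<subseteq> S \<and> x \<in> ideal_gen (\<Union>F)"
  using assms
proof induction
  case bottom
  show ?case by (rule exI[of _ "{}"]) (simp add: ideal_gen.bottom)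
next
  case (base u)
  then obtain I where "I \<in> S" "u \<in> I" by blast
  then show ?case by (intro exI[of _ "{I}"]) (simp add: ideal_gen.base)
next
  case (join a b)
  then obtain F G where "finite F" "F \<subseteq> S" "a \<in> ideal_gen (\<Union>F)"
    and "finite G" "G \<subseteq> S" "b \<in> ideal_gen (\<Union>G)" by blast
  moreover from this have "a \<in> ideal_gen (\<Union>(F \<union> G))" "b \<in> ideal_gen (\<Union>(F \<union> G))"
    using ideal_gen_mono[of "\<Union>F" "\<Union>(F \<union> G)"] ideal_gen_mono[of "\<Union>G" "\<Union>(F \<union> G)"] by auto
  ultimately show ?case
    by (intro exI[of _ "F \<union> G"]) (simp add: ideal_gen.join)
next
  case (down b a)
  then show ?case by (blast intro: ideal_gen.down)
qed

lemma meet_mono_right: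
  assumes "a \<in> carrier L" "x \<in> carrier L" "y \<in> carrier L" "x \<sqsubseteq> y"
  shows "a \<sqinter> x \<sqsubseteq> a \<sqinter> y"
proof (rule meet_le)
  show "a \<sqinter> x \<sqsubseteq> y"
    using assms meet_right[of a x] le_trans[of "a \<sqinter> x" x y] by simp
qed (use assms in \<open>simp_all add: meet_left\<close>)

lemma meet_absorb:
  assumes "a \<in> carrier L" "b \<in> carrier L" "a \<sqsubseteq> b"
  shows "a \<sqinter> b = a"
  by (rule le_antisym) (use assms in \<open>auto intro: meet_left meet_le\<close>)

lemma meet_join_distrib:
  assumes "a \<in> carrier L" "x \<in> carrier L" "y \<in> carrier L"
  shows "a \<sqinter> (x \<squnion> y) = (a \<sqinter> x) \<squnion> (a \<sqinter> y)"
  using inf_Sup_distrib[of a "{x, y}"] assms by (simp add: join_def)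

lemma lattice_ideal_Int:
  assumes "lattice_ideal L I" "lattice_ideal L J"
  shows "lattice_ideal L (I \<inter> J)"
  using assms unfolding lattice_ideal_def by blast

text \<open>This becomes the frame law for round ideals once joins are identified with generated
  ideals and binary meets with intersections. The inclusion from left to right rests on
  distributivity in \<open>L\<close>, used in the \<open>join\<close> case.\<close>

lemma ideal_gen_Union_Int:
  assumes I: "lattice_ideal L I" and S: "\<And>J. J \<in> S \<Longrightarrow> lattice_ideal L J"
  shows "I \<inter> ideal_gen (\<Union>S) = ideal_gen (\<Union>((\<inter>) I ` S))" (is "?l = ?r")
proof
  have S_car: "\<Union>S \<subseteq> carrier L" using S unfolding lattice_ideal_def by blast
  note gen_car = ideal_gen_carrier[OF S_car, THEN subsetD]
  \<comment> \<open>Meeting with a fixed \<open>a\<close> can be pushed through a derivation of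
    \<open>x\<close> down to its generators, where \<open>a \<sqinter> u\<close> falls into
    \<open>I \<inter> J\<close>.\<close>
  have meet_mem: "a \<sqinter> x \<in> ?r" if a: "a \<in> I" and x: "x \<in> ideal_gen (\<Union>S)" for a x
    using x
  proof induction
    have a_car: "a \<in> carrier L" using a I unfolding lattice_ideal_def by blast
    {
      case bottom
      then show ?case
        by (rule ideal_gen.down[OF ideal_gen.bottom]) (simp_all add: a_car meet_right)
    next
      case (base u)
      then obtain J where J: "J \<in> S" "u \<in> J" by blast
      have "u \<in> carrier L" using base S_car by blast
      then have "a \<sqinter> u \<in> I \<inter> J"
        using a a_car J I S[OF J(1)] unfolding lattice_ideal_def
        by (meson IntI meet_closed meet_left meet_right)
      then show ?case using J by (blast intro: ideal_gen.base)
    next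
      case (join x y)
      then show ?case by (simp add: meet_join_distrib a_car gen_car ideal_gen.join)
    next
      case (down y x)
      then show ?case
        by (intro ideal_gen.down[OF down.IH]) (simp_all add: a_car gen_car meet_mono_right)
    }
  qed
  show "?l \<subseteq> ?r"
  proof
    \<comment> \<open>An element of both sides is its own meet \<open>a \<sqinter> a\<close>, so
      \<open>meet_mem\<close> applies with \<open>x = a\<close>.\<close>
    fix a assume a: "a \<in> ?l"
    then have "a \<in> carrier L" using gen_car by blast
    then show "a \<in> ?r" using meet_mem[of a a] a by (simp add: meet_absorb)
  qed
  have "lattice_ideal L ?l"
    by (rule lattice_ideal_Int[OF I lattice_ideal_ideal_gen[OF S_car]])
  then show "?r \<subseteq> ?l"
    by (rule ideal_gen_least) (auto intro: ideal_gen.base)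
qed

lemma sup_mono_subset:
  assumes "A \<subseteq> B" "B \<subseteq> carrier L"
  shows "\<Squnion>A \<sqsubseteq> \<Squnion>B"
  by (rule sup_least) (use assms in \<open>auto intro: sup_upper\<close>)

text \<open>Applying the frame law twice reduces the claim to meets \<open>j \<sqinter> i\<close> of
  single elements, and these lie in both ideals because ideals are downsets.\<close>

lemma meet_sup_le_sup_Int:
  assumes I: "lattice_ideal L I" and J: "lattice_ideal L J"
  shows "\<Squnion>I \<sqinter> \<Squnion>J \<sqsubseteq> \<Squnion>(I \<inter> J)"
proof -
  have car: "I \<subseteq> carrier L" "J \<subseteq> carrier L" using I J unfolding lattice_ideal_def by auto
  then have IJ: "I \<inter> J \<subseteq> carrier L" by blast
  have 1: "\<Squnion>I \<sqinter> j \<sqsubseteq> \<Squnion>(I \<inter> J)" if j: "j \<in> J" for j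
  proof -
    have jc: "j \<in> carrier L" using j car by blast
    have "j \<sqinter> i \<sqsubseteq> \<Squnion>(I \<inter> J)" if i: "i \<in> I" for i
    proof (rule sup_upper[OF IJ])
      have "i \<in> carrier L" using i car by blast
      then show "j \<sqinter> i \<in> I \<inter> J"
        using i j jc I J unfolding lattice_ideal_def by (meson IntI meet_closed meet_left meet_right)
    qed
    then have "j \<sqinter> \<Squnion>I \<sqsubseteq> \<Squnion>(I \<inter> J)"
      using jc car IJ by (subst inf_Sup_distrib) (auto intro!: sup_least)
    then show ?thesis by (simp add: meet_comm)
  qed
  show ?thesis
    using car IJ 1 by (subst inf_Sup_distrib) (auto intro!: sup_least)
qed

end

section \<open>The frame structure of the round ideals\<close>

context proximity_frame
begin

abbreviation RL :: "'a set gorder" where "RL \<equiv> round_ideals L (\<prec>)"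

lemma carrier_RL: "carrier RL = {I. round_ideal L (\<prec>) I}"
  and le_RL: "I \<sqsubseteq>\<^bsub>RL\<^esub> J \<longleftrightarrow> I \<subseteq> J"
  by (simp_all add: round_ideals_def)

lemma RL_ideal: "I \<in> carrier RL \<Longrightarrow> lattice_ideal L I"
  by (simp add: carrier_RL round_ideal_def)

lemma RL_subset: "I \<in> carrier RL \<Longrightarrow> I \<subseteq> carrier L"
  using RL_ideal unfolding lattice_ideal_def by blast

lemma RL_downward: "\<lbrakk> I \<in> carrier RL; b \<in> I; a \<in> carrier L; a \<sqsubseteq> b \<rbrakk> \<Longrightarrow> a \<in> I"
  using RL_ideal unfolding lattice_ideal_def by blast

lemma RL_Union_subset: "S \<subseteq> carrier RL \<Longrightarrow> \<Union>S \<subseteq> carrier L"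
  using RL_subset by blast

text \<open>Each rule preserves roundness: \<open>prec_bottom\<close> handles \<open>bottom\<close>,
  roundness of the members of \<open>S\<close> handles the generators, \<open>prec_join\<close>
  handles joins, and a witness for \<open>b\<close> also serves every element below
  \<open>b\<close>.\<close>

lemma ideal_gen_in_RL:
  assumes "S \<subseteq> carrier RL"
  shows "ideal_gen (\<Union>S) \<in> carrier RL"
proof -
  have "\<exists>b\<in>ideal_gen (\<Union>S). a \<prec> b" if "a \<in> ideal_gen (\<Union>S)" for a
    using that
  proof induction
    case bottom
    show ?case using prec_bottom ideal_gen.bottom by blast
  next
    case (base u)
    then obtain I where "I \<in> S" "u \<in> I" by blast
    then obtain b where "b \<in> I" "u \<prec> b"
      using assms unfolding carrier_RL round_ideal_def by blast
    then show ?case using \<open>I \<in> S\<close> by (blast intro: ideal_gen.base)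
  next
    case (join a b)
    then show ?case by (blast intro: ideal_gen.join prec_join)
  next
    case (down b a)
    then obtain c where "c \<in> ideal_gen (\<Union>S)" "b \<prec> c" by blast
    then show ?case using down prec_carrier le_prec_le le_refl by blast
  qed
  then show ?thesis
    using lattice_ideal_ideal_gen[OF RL_Union_subset[OF assms]]
    by (simp add: carrier_RL round_ideal_def)
qed

lemma RL_partial_order: "partial_order RL"
  by unfold_locales (auto simp: round_ideals_def)

lemma RL_is_lub:
  assumes "S \<subseteq> carrier RL"
  shows "is_lub RL (ideal_gen (\<Union>S)) S"
proof (rule least_UpperI)
  fix J assume J: "J \<in> Upper RL S"
  then have "J \<in> carrier RL" "\<Union>S \<subseteq> J"
    using assms by (auto simp: Upper_def le_RL)
  then show "ideal_gen (\<Union>S) \<sqsubseteq>\<^bsub>RL\<^esub> J"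
    using ideal_gen_least[OF RL_ideal] by (simp add: le_RL)
qed (use assms ideal_gen_in_RL in \<open>auto simp: le_RL intro: ideal_gen.base\<close>)

lemma RL_sup_eq:
  assumes "S \<subseteq> carrier RL"
  shows "\<Squnion>\<^bsub>RL\<^esub>S = ideal_gen (\<Union>S)"
proof -
  interpret R: partial_order RL by (rule RL_partial_order)
  \<comment> \<open>\<open>sup\<close> is a choice among least upper bounds; existence makes the
    choice legitimate, and uniqueness then identifies it.\<close>
  have "is_lub RL (\<Squnion>\<^bsub>RL\<^esub>S) S"
    unfolding sup_def using RL_is_lub[OF assms] by (rule someI)
  then show ?thesis using RL_is_lub[OF assms] by (rule R.least_unique)
qed

lemma RL_Int:
  assumes "I \<in> carrier RL" "J \<in> carrier RL"
  shows "I \<inter> J \<in> carrier RL"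
proof -
  have "\<exists>d\<in>I \<inter> J. a \<prec> d" if a: "a \<in> I" "a \<in> J" for a
  proof -
    obtain b c where bc: "b \<in> I" "a \<prec> b" "c \<in> J" "a \<prec> c"
      using a assms unfolding carrier_RL round_ideal_def by blast
    have car: "a \<in> carrier L" "b \<in> carrier L" "c \<in> carrier L" using bc prec_carrier by auto
    \<comment> \<open>\<open>prec_meet\<close> yields
      \<open>a \<sqinter> a \<prec> b \<sqinter> c\<close>, so the meet of the two witnesses shows
      roundness of the intersection.\<close>
    then have "a \<prec> b \<sqinter> c"
      using prec_meet[OF bc(2,4)] by (simp add: meet_absorb)
    moreover have "b \<sqinter> c \<in> I \<inter> J"
      using bc car assms by (auto intro: RL_downward meet_left meet_right)
    ultimately show ?thesis by blast
  qed
  then show ?thesis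
    using lattice_ideal_Int[OF assms[THEN RL_ideal]] by (simp add: carrier_RL round_ideal_def)
qed

lemma RL_meet_eq:
  assumes "I \<in> carrier RL" "J \<in> carrier RL"
  shows "I \<sqinter>\<^bsub>RL\<^esub> J = I \<inter> J"
proof -
  interpret R: partial_order RL by (rule RL_partial_order)
  have glb: "is_glb RL (I \<inter> J) {I, J}"
    using assms RL_Int by (intro greatest_LowerI) (auto simp: Lower_def le_RL)
  then have "is_glb RL (I \<sqinter>\<^bsub>RL\<^esub> J) {I, J}"
    unfolding meet_def inf_def by (rule someI)
  then show ?thesis using glb by (rule R.greatest_unique)
qed

lemma RL_complete_lattice: "complete_lattice RL"
proof -
  interpret R: partial_order RL by (rule RL_partial_order)
  show ?thesis
  proof
    fix S assume S: "S \<subseteq> carrier RL"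
    then show "\<exists>s. is_lub RL s S" using RL_is_lub by blast
    \<comment> \<open>An infinite intersection of round ideals need not be round, so the infimum is
      built as the join of all lower bounds.\<close>
    have "is_lub RL (ideal_gen (\<Union>(Lower RL S))) (Lower RL S)"
      by (rule RL_is_lub) simp
    then have "is_glb RL (ideal_gen (\<Union>(Lower RL S))) S"
      using S by (intro greatest_LowerI)
        (auto simp: least_def Upper_def Lower_def subset_iff)
    then show "\<exists>i. is_glb RL i S" by blast
  qed
qed

lemma RL_frame: "frame RL"
proof -
  interpret R: complete_lattice RL by (rule RL_complete_lattice)
  show ?thesis
  proof
    fix I S assume I: "I \<in> carrier RL" and S: "S \<subseteq> carrier RL"
    have eq: "(\<lambda>J. I \<sqinter>\<^bsub>RL\<^esub> J) ` S = (\<inter>) I ` S"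
      using I S by (auto simp: RL_meet_eq image_iff subset_iff)
    have "(\<inter>) I ` S \<subseteq> carrier RL" using I S RL_Int by blast
    then show "I \<sqinter>\<^bsub>RL\<^esub> \<Squnion>\<^bsub>RL\<^esub>S = \<Squnion>\<^bsub>RL\<^esub>((\<lambda>J. I \<sqinter>\<^bsub>RL\<^esub> J) ` S)"
      using I S ideal_gen_Union_Int[OF RL_ideal[OF I], of S] RL_ideal
      by (simp add: eq RL_sup_eq RL_meet_eq ideal_gen_in_RL subset_iff)
  qed
qed

section \<open>The map \<open>kappa\<close> and the way-below relation\<close>

lemma mem_kappa: "b \<in> kappa L (\<prec>) a \<longleftrightarrow> b \<prec> a"
  using prec_carrier by (auto simp: kappa_def)

lemma prec_le_trans: "\<lbrakk> a \<prec> b; b \<sqsubseteq> c; c \<in> carrier L \<rbrakk> \<Longrightarrow> a \<prec> c"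
  using le_prec_le[of a c a b] prec_carrier[of a b] by auto

lemma le_prec_trans: "\<lbrakk> a \<sqsubseteq> b; b \<prec> c; a \<in> carrier L \<rbrakk> \<Longrightarrow> a \<prec> c"
  using le_prec_le[of a c b c] prec_carrier[of b c] by auto

lemma join_prec:
  assumes "a \<prec> c" "b \<prec> c"
  shows "a \<squnion> b \<prec> c"
proof -
  have "c \<in> carrier L" using assms prec_carrier by blast
  then show ?thesis
    using prec_le_trans[OF prec_join[OF assms]] by (auto intro: join_le)
qed

text \<open>Roundness is exactly interpolation for \<open>\<prec>\<close>; closure under joins is
  \<open>join_prec\<close>.\<close>

lemma kappa_in_RL:
  assumes "a \<in> carrier L"
  shows "kappa L (\<prec>) a \<in> carrier RL"
proof -
  have "\<bottom> \<prec> a" using prec_le_trans[OF prec_bottom] assms by auto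
  moreover have "\<exists>b\<in>kappa L (\<prec>) a. x \<prec> b" if "x \<prec> a" for x
    using prec_interpolate[OF that] by (auto simp: mem_kappa)
  ultimately show ?thesis
    by (auto simp: carrier_RL round_ideal_def lattice_ideal_def mem_kappa
        dest: prec_carrier intro: le_prec_trans join_prec)
qed

lemma sup_kappa:
  assumes "a \<in> carrier L"
  shows "\<Squnion>(kappa L (\<prec>) a) = a"
proof -
  have "kappa L (\<prec>) a = {b. b \<prec> a}" by (auto simp: mem_kappa)
  then show ?thesis using prec_approx[OF assms] by simp
qed

text \<open>From left to right, a finite subcover of a suitable cover of
  \<open>kappa L (\<prec>) c\<close> lies under one element \<open>d \<prec> c\<close>. From right
  to left, compactness is needed only for the single element \<open>\<Squnion>I\<close>, which is a
  member of \<open>kappa L (\<prec>) c\<close>.\<close>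

lemma way_below_kappa_iff:
  assumes I: "I \<in> carrier RL" and c: "c \<in> carrier L"
  shows "way_below RL I (kappa L (\<prec>) c) \<longleftrightarrow> \<Squnion>I \<prec> c"
proof
  have I_car: "I \<subseteq> carrier L" using I RL_subset by blast
  assume "way_below RL I (kappa L (\<prec>) c)"
  moreover define S where "S = kappa L (\<prec>) ` {b. b \<prec> c}"
  have S: "S \<subseteq> carrier RL" unfolding S_def using kappa_in_RL prec_carrier by blast
  moreover have "kappa L (\<prec>) c \<sqsubseteq>\<^bsub>RL\<^esub> \<Squnion>\<^bsub>RL\<^esub>S"
  proof -
    \<comment> \<open>The interpolant between \<open>a\<close> and \<open>c\<close> indexes a member
      of \<open>S\<close> containing \<open>a\<close>, so \<open>S\<close> covers
      \<open>kappa L (\<prec>) c\<close>.\<close>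
    have "a \<in> \<Union>S" if "a \<prec> c" for a
      using prec_interpolate[OF that] unfolding S_def by (auto simp: mem_kappa)
    then show ?thesis
      unfolding le_RL RL_sup_eq[OF S] by (auto simp: mem_kappa intro: ideal_gen.base)
  qed
  ultimately obtain F where F: "finite F" "F \<subseteq> S" "I \<sqsubseteq>\<^bsub>RL\<^esub> \<Squnion>\<^bsub>RL\<^esub>F"
    unfolding way_below_def by blast
  obtain B where B: "finite B" "B \<subseteq> {b. b \<prec> c}" "F = kappa L (\<prec>) ` B"
    using finite_subset_image[OF F(1) F(2)[unfolded S_def]] by auto
  \<comment> \<open>The elements \<open>\<prec> c\<close> are closed under finite joins, so
    \<open>B\<close> has an upper bound among them; for empty \<open>B\<close> it is
    \<open>\<bottom>\<close>.\<close>
  have "\<exists>d. d \<prec> c \<and> (\<forall>b\<in>B. b \<sqsubseteq> d)"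
    using B(1,2)
  proof induction
    case empty
    show ?case using prec_le_trans[OF prec_bottom] c by auto
  next
    case (insert b B)
    then obtain d where d: "d \<prec> c" "\<forall>b\<in>B. b \<sqsubseteq> d" by auto
    have car: "b \<in> carrier L" "d \<in> carrier L" "B \<subseteq> carrier L"
      using insert.prems d prec_carrier by auto
    then have "\<forall>x\<in>insert b B. x \<sqsubseteq> b \<squnion> d"
      using d by (auto intro: join_left join_right le_trans[OF _ join_right])
    moreover have "b \<squnion> d \<prec> c" using insert.prems d by (simp add: join_prec)
    ultimately show ?case by blast
  qed
  then obtain d where d: "d \<prec> c" "\<And>b. b \<in> B \<Longrightarrow> b \<sqsubseteq> d" by blast
  have d_car: "d \<in> carrier L" using d prec_carrier by blast
  have "\<Union>F \<subseteq> kappa L (\<prec>) d"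
    using prec_le_trans[OF _ d(2) d_car] B(3) by (auto simp: mem_kappa)
  then have "ideal_gen (\<Union>F) \<subseteq> kappa L (\<prec>) d"
    using ideal_gen_least[OF RL_ideal[OF kappa_in_RL[OF d_car]]] by blast
  then have "I \<subseteq> kappa L (\<prec>) d"
    using F S RL_sup_eq[of F] by (auto simp: le_RL)
  then have "\<Squnion>I \<sqsubseteq> d"
    using I_car d_car prec_imp_le by (intro sup_least) (auto simp: mem_kappa)
  then show "\<Squnion>I \<prec> c" using le_prec_trans d I_car by auto
next
  have I_car: "I \<subseteq> carrier L" using I RL_subset by blast
  assume prec: "\<Squnion>I \<prec> c"
  have "\<exists>F. finite F \<and> F \<subseteq> S \<and> I \<sqsubseteq>\<^bsub>RL\<^esub> \<Squnion>\<^bsub>RL\<^esub>F"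
    if S: "S \<subseteq> carrier RL" and le: "kappa L (\<prec>) c \<sqsubseteq>\<^bsub>RL\<^esub> \<Squnion>\<^bsub>RL\<^esub>S" for S
  proof -
    \<comment> \<open>Finitely many members of \<open>S\<close> already generate
      \<open>\<Squnion>I\<close>, hence by downward closure every element of
      \<open>I\<close>.\<close>
    have "\<Squnion>I \<in> ideal_gen (\<Union>S)"
      using prec le by (auto simp: le_RL RL_sup_eq[OF S] mem_kappa)
    then obtain F where F: "finite F" "F \<subseteq> S" "\<Squnion>I \<in> ideal_gen (\<Union>F)"
      using ideal_gen_Union_finite by blast
    have "I \<subseteq> ideal_gen (\<Union>F)"
      using F(3) I_car by (auto intro: ideal_gen.down sup_upper)
    moreover have "F \<subseteq> carrier RL" using F S by blast
    ultimately show ?thesis using F by (intro exI[of _ F]) (simp add: le_RL RL_sup_eq)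
  qed
  then show "way_below RL I (kappa L (\<prec>) c)"
    unfolding way_below_def using I kappa_in_RL[OF c] by blast
qed

text \<open>The case \<open>c = \<Squnion>J\<close> of \<open>way_below_kappa_iff\<close>. It
  contains the maximality claim, and the proximity axioms are verified through it.\<close>

lemma round_ideal_prox_iff:
  "round_ideal_prox L (\<prec>) I J \<longleftrightarrow>
     I \<in> carrier RL \<and> J \<in> carrier RL \<and> I \<subseteq> J \<and> \<Squnion>I \<prec> \<Squnion>J"
  unfolding round_ideal_prox_def ideal_join_def
  using way_below_kappa_iff[of I "\<Squnion>J"] RL_subset[of J] by auto

section \<open>Bounds and binary joins of round ideals, and suprema of joins and
  intersections\<close>

lemma RL_bottom: "\<bottom>\<^bsub>RL\<^esub> = {\<bottom>}"
proof -
  interpret R: complete_lattice RL by (rule RL_complete_lattice)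
  have "{\<bottom>} \<in> carrier RL"
    by (auto simp: carrier_RL round_ideal_def lattice_ideal_def prec_bottom
        intro!: le_antisym join_le)
  moreover have "\<bottom> \<in> \<bottom>\<^bsub>RL\<^esub>"
    using RL_ideal[OF R.bottom_closed] by (simp add: lattice_ideal_def)
  moreover have "\<bottom>\<^bsub>RL\<^esub> \<subseteq> {\<bottom>}"
    using R.bottom_lower[OF calculation(1)] by (simp add: le_RL)
  ultimately show ?thesis by blast
qed

lemma RL_top: "\<top>\<^bsub>RL\<^esub> = carrier L"
proof -
  interpret R: complete_lattice RL by (rule RL_complete_lattice)
  have "carrier L \<in> carrier RL"
    \<comment> \<open>Every element is below \<open>\<top>\<close> and
      \<open>\<top> \<prec> \<top>\<close>, so \<open>\<top>\<close> witnesses roundness for all of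
      \<open>carrier L\<close>.\<close>
    using le_prec_trans[OF top_higher prec_top]
    by (auto simp: carrier_RL round_ideal_def lattice_ideal_def)
  then have "carrier L \<subseteq> \<top>\<^bsub>RL\<^esub>" using R.top_higher by (simp add: le_RL)
  then show ?thesis using RL_subset[OF R.top_closed] by blast
qed

lemma RL_join_eq:
  assumes "I \<in> carrier RL" "J \<in> carrier RL"
  shows "I \<squnion>\<^bsub>RL\<^esub> J = ideal_gen (I \<union> J)"
  using RL_sup_eq[of "{I, J}"] assms by (simp add: join_def)

text \<open>Passing to the generated ideal creates no new constraint on upper bounds
  (\<open>ideal_gen_le\<close>), so its supremum is that of the union.\<close>

lemma sup_ideal_gen_Un:
  assumes "I \<subseteq> carrier L" "J \<subseteq> carrier L"
  shows "\<Squnion>(ideal_gen (I \<union> J)) = \<Squnion>I \<squnion> \<Squnion>J"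
proof (rule le_antisym)
  have gen: "ideal_gen (I \<union> J) \<subseteq> carrier L" using assms ideal_gen_carrier by simp
  have "x \<sqsubseteq> \<Squnion>I \<squnion> \<Squnion>J" if "x \<in> I \<union> J" for x
  proof -
    have "x \<in> carrier L" "x \<sqsubseteq> \<Squnion>I \<or> x \<sqsubseteq> \<Squnion>J" using that assms by (auto intro: sup_upper)
    then show ?thesis
      using assms by (meson join_closed join_left join_right le_trans sup_closed)
  qed
  then show "\<Squnion>(ideal_gen (I \<union> J)) \<sqsubseteq> \<Squnion>I \<squnion> \<Squnion>J"
    using assms gen ideal_gen_le[of "I \<union> J" "\<Squnion>I \<squnion> \<Squnion>J"] by (auto intro!: sup_least)
  show "\<Squnion>I \<squnion> \<Squnion>J \<sqsubseteq> \<Squnion>(ideal_gen (I \<union> J))"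
    using assms gen
    by (intro join_le sup_mono_subset) (auto intro: ideal_gen.base)
  show "\<Squnion>(ideal_gen (I \<union> J)) \<in> carrier L" using gen by simp
  show "\<Squnion>I \<squnion> \<Squnion>J \<in> carrier L" using assms by simp
qed

lemma sup_Int_RL:
  assumes "I \<in> carrier RL" "J \<in> carrier RL"
  shows "\<Squnion>(I \<inter> J) = \<Squnion>I \<sqinter> \<Squnion>J"
proof (rule le_antisym)
  note sub = assms[THEN RL_subset]
  then have IJ: "I \<inter> J \<subseteq> carrier L" by blast
  show "\<Squnion>(I \<inter> J) \<sqsubseteq> \<Squnion>I \<sqinter> \<Squnion>J"
    using sub IJ by (intro meet_le sup_mono_subset) auto
  show "\<Squnion>I \<sqinter> \<Squnion>J \<sqsubseteq> \<Squnion>(I \<inter> J)"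
    by (rule meet_sup_le_sup_Int[OF assms[THEN RL_ideal]])
  show "\<Squnion>(I \<inter> J) \<in> carrier L" using IJ by simp
  show "\<Squnion>I \<sqinter> \<Squnion>J \<in> carrier L" using sub by simp
qed

section \<open>Verification of the proximity axioms\<close>

lemma round_ideal_prox_interpolate:
  assumes "round_ideal_prox L (\<prec>) I J"
  shows "\<exists>K. round_ideal_prox L (\<prec>) I K \<and> round_ideal_prox L (\<prec>) K J"
proof -
  have I: "I \<in> carrier RL" and J: "J \<in> carrier RL" and "I \<subseteq> J" "\<Squnion>I \<prec> \<Squnion>J"
    using assms by (auto simp: round_ideal_prox_iff)
  obtain c where c: "\<Squnion>I \<prec> c" "c \<prec> \<Squnion>J" using prec_interpolate \<open>\<Squnion>I \<prec> \<Squnion>J\<close> by blast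
  have c_car: "c \<in> carrier L" using c prec_carrier by blast
  \<comment> \<open>\<open>kappa L (\<prec>) c\<close> has the right supremum \<open>c\<close> but
    need not lie inside \<open>J\<close>. Intersecting with \<open>J\<close> repairs this and leaves
    the supremum at \<open>c \<sqinter> \<Squnion>J = c\<close>.\<close>
  let ?K = "kappa L (\<prec>) c \<inter> J"
  have K: "?K \<in> carrier RL" using RL_Int kappa_in_RL c_car J by blast
  have "\<Squnion>?K = c"
    using sup_Int_RL[OF kappa_in_RL[OF c_car] J] c_car prec_imp_le[OF c(2)] RL_subset[OF J]
    by (simp add: sup_kappa meet_absorb)
  moreover have "I \<subseteq> ?K"
  proof
    fix a assume a: "a \<in> I"
    have "a \<in> carrier L" using a RL_subset[OF I] by blast
    moreover have "a \<sqsubseteq> \<Squnion>I" using a RL_subset[OF I] by (simp add: sup_upper)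
    ultimately have "a \<prec> c" using le_prec_trans c(1) by blast
    then show "a \<in> ?K" using a \<open>I \<subseteq> J\<close> by (auto simp: mem_kappa)
  qed
  ultimately show ?thesis
    using c I J K by (intro exI[of _ ?K]) (simp add: round_ideal_prox_iff)
qed

lemma round_ideal_prox_approx:
  assumes I: "I \<in> carrier RL"
  shows "I = \<Squnion>\<^bsub>RL\<^esub>{K. round_ideal_prox L (\<prec>) K I}" (is "_ = \<Squnion>\<^bsub>RL\<^esub>?S")
proof -
  have S: "?S \<subseteq> carrier RL" by (auto simp: round_ideal_prox_iff)
  have "ideal_gen (\<Union>?S) \<subseteq> I"
    by (rule ideal_gen_least[OF RL_ideal[OF I]]) (auto simp: round_ideal_prox_iff)
  moreover have "a \<in> ideal_gen (\<Union>?S)" if a: "a \<in> I" for a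
  proof -
    have round: "\<exists>y\<in>I. x \<prec> y" if "x \<in> I" for x
      using that I unfolding carrier_RL round_ideal_def by blast
    \<comment> \<open>Roundness is used twice: \<open>a \<prec> b\<close> puts \<open>a\<close> into
      \<open>kappa L (\<prec>) b\<close>, while \<open>b \<prec> b'\<close> with \<open>b'\<close>
      in \<open>I\<close> gives \<open>b \<prec> \<Squnion>I\<close>, so that this ideal belongs to
      \<open>?S\<close>.\<close>
    obtain b b' where b: "b \<in> I" "a \<prec> b" "b' \<in> I" "b \<prec> b'" using round a by meson
    have b_car: "b \<in> carrier L" using b prec_carrier by blast
    have "kappa L (\<prec>) b \<subseteq> I"
      using RL_downward[OF I b(1)] prec_carrier prec_imp_le by (auto simp: mem_kappa)
    moreover have "b \<prec> \<Squnion>I"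
      using b RL_subset[OF I] by (intro prec_le_trans[OF b(4)]) (auto intro: sup_upper)
    ultimately have "kappa L (\<prec>) b \<in> ?S"
      using I b_car by (simp add: round_ideal_prox_iff kappa_in_RL sup_kappa)
    moreover have "a \<in> kappa L (\<prec>) b" using b by (simp add: mem_kappa)
    ultimately show ?thesis by (blast intro: ideal_gen.base)
  qed
  ultimately show ?thesis unfolding RL_sup_eq[OF S] by blast
qed

lemma round_ideal_prox_proximity_frame: "proximity_frame RL (round_ideal_prox L (\<prec>))"
proof -
  interpret R: frame RL by (rule RL_frame)
  show ?thesis
  proof
    fix I J assume "round_ideal_prox L (\<prec>) I J"
    then show "I \<in> carrier RL \<and> J \<in> carrier RL" "I \<sqsubseteq>\<^bsub>RL\<^esub> J"
      "\<exists>K. round_ideal_prox L (\<prec>) I K \<and> round_ideal_prox L (\<prec>) K J"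
      using round_ideal_prox_interpolate by (auto simp: round_ideal_prox_iff le_RL)
  next
    show "round_ideal_prox L (\<prec>) \<bottom>\<^bsub>RL\<^esub> \<bottom>\<^bsub>RL\<^esub>"
      using R.bottom_closed prec_bottom by (simp add: round_ideal_prox_iff RL_bottom)
  next
    have "\<Squnion>(carrier L) = \<top>" by (rule le_antisym) (auto intro: sup_upper)
    then show "round_ideal_prox L (\<prec>) \<top>\<^bsub>RL\<^esub> \<top>\<^bsub>RL\<^esub>"
      using R.top_closed prec_top by (simp add: round_ideal_prox_iff RL_top)
  next
    fix I1 J1 I2 J2
    assume "round_ideal_prox L (\<prec>) I1 J1" "round_ideal_prox L (\<prec>) I2 J2"
    then have car: "I1 \<in> carrier RL" "J1 \<in> carrier RL" "I2 \<in> carrier RL" "J2 \<in> carrier RL"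
      and le: "I1 \<subseteq> J1" "I2 \<subseteq> J2" and prec: "\<Squnion>I1 \<prec> \<Squnion>J1" "\<Squnion>I2 \<prec> \<Squnion>J2"
      by (auto simp: round_ideal_prox_iff)
    show "round_ideal_prox L (\<prec>) (I1 \<sqinter>\<^bsub>RL\<^esub> I2) (J1 \<sqinter>\<^bsub>RL\<^esub> J2)"
      using car le prec_meet[OF prec]
      by (auto simp: round_ideal_prox_iff RL_meet_eq RL_Int sup_Int_RL)
    have "ideal_gen (I1 \<union> I2) \<subseteq> ideal_gen (J1 \<union> J2)"
      using le by (intro ideal_gen_mono) blast
    \<comment> \<open>Membership of the two generated ideals in \<open>carrier RL\<close> comes from
      \<open>R.join_closed\<close>, rewritten by \<open>RL_join_eq\<close>.\<close>
    then show "round_ideal_prox L (\<prec>) (I1 \<squnion>\<^bsub>RL\<^esub> I2) (J1 \<squnion>\<^bsub>RL\<^esub> J2)"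
      using car prec_join[OF prec] R.join_closed[of I1 I2] R.join_closed[of J1 J2]
      by (simp add: round_ideal_prox_iff RL_join_eq sup_ideal_gen_Un RL_subset)
  next
    fix I J I' J'
    assume car: "I \<in> carrier RL" "J' \<in> carrier RL"
      and le: "I \<sqsubseteq>\<^bsub>RL\<^esub> I'" "J \<sqsubseteq>\<^bsub>RL\<^esub> J'" and prox: "round_ideal_prox L (\<prec>) I' J"
    have "I' \<subseteq> carrier L" "J' \<subseteq> carrier L"
      using prox car RL_subset by (simp_all add: round_ideal_prox_iff)
    then have "\<Squnion>I \<sqsubseteq> \<Squnion>I'" "\<Squnion>J \<sqsubseteq> \<Squnion>J'"
      using le by (simp_all add: sup_mono_subset le_RL)
    then show "round_ideal_prox L (\<prec>) I J'"
      using car le prox le_prec_le[of "\<Squnion>I" "\<Squnion>J'"] RL_subset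
      by (auto simp: round_ideal_prox_iff le_RL)
  next
    fix I assume "I \<in> carrier RL"
    then show "I = \<Squnion>\<^bsub>RL\<^esub>{K. round_ideal_prox L (\<prec>) K I}"
      by (rule round_ideal_prox_approx)
  qed
qed

end

theorem proposition4p10:
  fixes L :: "('a, 'm) gorder_scheme" and prec :: "'a \<Rightarrow> 'a \<Rightarrow> bool"
  assumes "proximity_frame L prec"
  shows "proximity_frame (round_ideals L prec) (round_ideal_prox L prec) \<and>
    (\<forall>I \<in> carrier (round_ideals L prec). \<forall>J \<in> carrier (round_ideals L prec).
       round_ideal_prox L prec I J \<longleftrightarrow> I \<subseteq> J \<and> prec (ideal_join L I) (ideal_join L J))"
proof -
  interpret proximity_frame L prec by (rule assms)
  show ?thesis
    using round_ideal_prox_proximity_frame by (simp add: round_ideal_prox_iff ideal_join_def)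
qed

end
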